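(* Let $n\geq 4$ be an integer and let $W_n$ be the wheel graph with $n+1$ vertices, in which one central vertex is adjacent to all vertices of an $n$-cycle. Then $$\gamma_{plsR}(W_n)=\begin{cases}\left\lceil\frac{n}{2}\right\rceil+1, & \text{if } n\equiv 0 \pmod 4,\\ \left\lceil\frac{n+1}{2}\right\rceil+1, & \text{otherwise.}\end{cases}$$
   Context: All graphs are finite, without loops or parallel edges. For a graph $G=(V,E)$ and $v\in V$, $N[v]=\{v\}\cup\{u : uv\in E\}$ is the closed neighborhood. A perfect locating signed Roman dominating (PLSRD) function on $G=(V,E)$ is a function $f: V\to\{-1,1,2\}$ such that: (C1) each vertex $v$ with $f(v)=-1$ is adjacent to exactly one vertex $u$ with $f(u)=2$; (C2) distinct vertices $v,w$ with $f(v)=f(w)=-1$ have no common neighbor $u$ with $f(u)=2$; (C3) for every vertex $v$, $\sum_{u\in N[v]} f(u)\geq 1$. The weight of $f$ is $f(V)=\sum_{v\in V} f(v)$. The perfect locating signed Roman domination number $\gamma_{plsR}(G)$ is the minimum weight over all PLSRD functions on $G$. *)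

theory Defs
  imports Complex_Main "Graph_Theory.Digraph"
begin

text \<open>
  Finite simple graphs are the symmetric, loop-free digraphs without parallel arcs of the
  locale \<^locale>\<open>graph\<close>: an edge \<open>uv\<close> is the pair of arcs \<open>u \<rightarrow> v\<close> and \<open>v \<rightarrow> u\<close>.
\<close>

definition closed_neighborhood :: "('a, 'b) pre_digraph \<Rightarrow> 'a \<Rightarrow> 'a set" where
  "closed_neighborhood G v = {v} \<union> {u. u \<rightarrow>\<^bsub>G\<^esub> v}"

text \<open>
  Perfect locating signed Roman dominating functions. The values of \<open>f\<close> outside
  \<open>verts G\<close> are unconstrained and irrelevant.
\<close>

definition PLSRD_function :: "('a, 'b) pre_digraph \<Rightarrow> ('a \<Rightarrow> int) \<Rightarrow> bool" where
  "PLSRD_function G f \<longleftrightarrow>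
     (\<forall>v \<in> verts G. f v \<in> {-1, 1, 2}) \<and>
     (\<forall>v \<in> verts G. f v = -1 \<longrightarrow> (\<exists>!u. u \<rightarrow>\<^bsub>G\<^esub> v \<and> f u = 2)) \<and>
     (\<forall>v \<in> verts G. \<forall>w \<in> verts G. v \<noteq> w \<and> f v = -1 \<and> f w = -1 \<longrightarrow>
        \<not> (\<exists>u. u \<rightarrow>\<^bsub>G\<^esub> v \<and> u \<rightarrow>\<^bsub>G\<^esub> w \<and> f u = 2)) \<and>
     (\<forall>v \<in> verts G. (\<Sum>u \<in> closed_neighborhood G v. f u) \<ge> 1)"

definition weight :: "('a, 'b) pre_digraph \<Rightarrow> ('a \<Rightarrow> int) \<Rightarrow> int" where
  "weight G f = (\<Sum>v \<in> verts G. f v)"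

definition PLSRD_number :: "('a, 'b) pre_digraph \<Rightarrow> int" where
  "PLSRD_number G = Min {weight G f | f. PLSRD_function G f}"

text \<open>The minimum is over a finite nonempty set, so \<^const>\<open>Min\<close> is meaningful.\<close>

lemma finite_PLSRD_weights:
  assumes "finite (verts G)"
  shows "finite {weight G f | f. PLSRD_function G f}"
proof (rule finite_subset)
  show "{weight G f | f. PLSRD_function G f} \<subseteq> {- int (card (verts G)) .. 2 * int (card (verts G))}"
  proof clarify
    fix f assume "PLSRD_function G f"
    then have *: "f v \<in> {-1, 1, 2}" if "v \<in> verts G" for v
      using that by (auto simp: PLSRD_function_def)
    have "weight G f \<ge> (\<Sum>v \<in> verts G. - 1)" "weight G f \<le> (\<Sum>v \<in> verts G. 2)"
      unfolding weight_def by (rule sum_mono; use * in fastforce)+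
    then show "weight G f \<in> {- int (card (verts G)) .. 2 * int (card (verts G))}"
      by simp
  qed
qed simp

lemma PLSRD_weights_nonempty:
  assumes "graph G"
  shows "{weight G f | f. PLSRD_function G f} \<noteq> {}"
proof -
  interpret graph G by fact
  have "card (closed_neighborhood G v) \<ge> 1" if "v \<in> verts G" for v
  proof -
    have "closed_neighborhood G v \<subseteq> insert v (verts G)"
      by (auto simp: closed_neighborhood_def arcs_ends_conv)
    then have "finite (closed_neighborhood G v)"
      by (rule finite_subset) simp
    moreover have "v \<in> closed_neighborhood G v"
      by (simp add: closed_neighborhood_def)
    ultimately show ?thesis
      by (metis One_nat_def Suc_leI card_gt_0_iff empty_iff)
  qed
  then have "PLSRD_function G (\<lambda>_. 1)"
    by (simp add: PLSRD_function_def)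
  then show ?thesis
    by blast
qed

text \<open>The wheel: rim vertices \<open>0, \<dots>, n - 1\<close> in cyclic order, and centre \<open>n\<close>.\<close>

definition wheel_edges :: "nat \<Rightarrow> (nat \<times> nat) set" where
  "wheel_edges n = {(i, Suc i mod n) | i. i < n} \<union> {(n, i) | i. i < n}"

definition wheel_graph :: "nat \<Rightarrow> (nat, nat \<times> nat) pre_digraph" where
  "wheel_graph n =
     \<lparr>verts = {0..n}, arcs = wheel_edges n \<union> (wheel_edges n)\<inverse>, tail = fst, head = snd\<rparr>"

lemma graph_wheel_graph:
  assumes "n \<ge> 3"
  shows "graph (wheel_graph n)"
proof -
  have sub: "wheel_edges n \<subseteq> {0..n} \<times> {0..n}"
    using assms by (auto simp: wheel_edges_def intro: less_imp_le)
  have irr: "(i, i) \<notin> wheel_edges n" for i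
    using assms by (cases "Suc i < n"; cases "Suc i = n") (auto simp: wheel_edges_def)
  show ?thesis
  proof
    show "finite (arcs (wheel_graph n))"
      using finite_subset[OF sub] by (simp add: wheel_graph_def)
    show "symmetric (wheel_graph n)"
      by (auto simp: symmetric_def arcs_ends_conv sym_def wheel_graph_def)
  qed (use sub irr in \<open>auto simp: wheel_graph_def arc_to_ends_def\<close>)
qed

end

theory Submission
  imports Defs
begin

text \<open>
  Condition C2 makes the map sending each vertex of value \<open>-1\<close> to its unique neighbour of
  value \<open>2\<close> injective. With \<open>m\<close> vertices of value \<open>-1\<close>, the weight is therefore at least
  \<open>\<bar>V\<bar> - m\<close>. In the wheel, \<open>m \<le> 1\<close> unless the centre has value \<open>1\<close>, and then \<open>2m \<le> n\<close>.
  If \<open>2m = n\<close>, the rim only takes the values \<open>-1\<close> and \<open>2\<close>, and the two rim neighbours of every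
  rim vertex have different values, which forces the pattern \<open>2, -1, -1, 2\<close> of period \<open>4\<close>.
  Conversely, repeating this pattern, with the remainder of the rim filled by \<open>1\<close>s or by
  \<open>1, -1, 2\<close>, attains the bound.
\<close>

section \<open>Weights in terms of the values $-1$ and $2$\<close>

text \<open>C1 supplies the choice of \<open>d\<close>, and C2 makes it injective. The map itself is
  exported, not only the cardinality bound, because the equality case on the wheel needs its
  surjectivity.\<close>

lemma PLSRD_private_neighbour:
  assumes "wf_digraph G" and "PLSRD_function G f"
  obtains d where "inj_on d {v \<in> verts G. f v = -1}"
    and "d ` {v \<in> verts G. f v = -1} \<subseteq> {v \<in> verts G. f v = 2}"
    and "\<And>v. v \<in> verts G \<Longrightarrow> f v = -1 \<Longrightarrow> d v \<rightarrow>\<^bsub>G\<^esub> v"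
proof -
  interpret wf_digraph G by fact
  have "\<forall>v \<in> {v \<in> verts G. f v = -1}. \<exists>u. u \<rightarrow>\<^bsub>G\<^esub> v \<and> f u = 2"
    using assms(2) unfolding PLSRD_function_def by blast
  then obtain d where d: "\<And>v. v \<in> verts G \<Longrightarrow> f v = -1 \<Longrightarrow> d v \<rightarrow>\<^bsub>G\<^esub> v \<and> f (d v) = 2"
    by (metis (mono_tags, lifting) mem_Collect_eq)
  have "inj_on d {v \<in> verts G. f v = -1}"
  proof (rule inj_onI, clarify, rule ccontr)
    fix v w assume "v \<in> verts G" "f v = -1" "w \<in> verts G" "f w = -1" "d v = d w" "v \<noteq> w"
    then show False
      using assms(2) d[of v] d[of w] unfolding PLSRD_function_def by metis
  qed
  moreover have "d ` {v \<in> verts G. f v = -1} \<subseteq> {v \<in> verts G. f v = 2}"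
    using d adj_in_verts(1) by blast
  ultimately show thesis
    using that d by blast
qed

lemma PLSRD_card_le:
  assumes "fin_digraph G" and "PLSRD_function G f"
  shows "card {v \<in> verts G. f v = -1} \<le> card {v \<in> verts G. f v = 2}"
proof -
  interpret fin_digraph G by fact
  show ?thesis
    by (rule PLSRD_private_neighbour[OF wf_digraph_axioms assms(2)]) (simp add: card_inj_on_le)
qed

lemma PLSRD_weight_eq:
  assumes "finite (verts G)" and "PLSRD_function G f"
  shows "weight G f = int (card (verts G)) - 2 * int (card {v \<in> verts G. f v = -1})
    + int (card {v \<in> verts G. f v = 2})"
proof -
  \<comment> \<open>On the three admissible values, \<open>f v\<close> is 1, minus twice the
    indicator of -1, plus the indicator of 2.\<close>
  have "weight G f = (\<Sum>v\<in>verts G. 1 - 2 * (if f v = -1 then 1 else 0) + (if f v = 2 then 1 else 0))"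
    unfolding weight_def
    by (rule sum.cong) (use assms(2) in \<open>auto simp: PLSRD_function_def\<close>)
  also have "\<dots> = int (card (verts G)) - 2 * (\<Sum>v\<in>verts G. if f v = -1 then 1 else 0)
      + (\<Sum>v\<in>verts G. if f v = 2 then 1 else 0)"
    by (simp add: sum.distrib sum_subtractf sum_distrib_left)
  finally show ?thesis
    using assms(1) by (simp add: sum.If_cases Int_def conj_commute)
qed

lemma PLSRD_weight_ge:
  assumes "fin_digraph G" and "PLSRD_function G f"
  shows "weight G f \<ge> int (card (verts G)) - int (card {v \<in> verts G. f v = -1})"
  using PLSRD_weight_eq[OF fin_digraph.finite_verts[OF assms(1)] assms(2)] PLSRD_card_le[OF assms]
  by simp

section \<open>Adjacency in the wheel\<close>

text \<open>For \<open>i < n\<close> this agrees with \<open>Suc i mod n\<close>. The case split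
  lets the simplifier treat the wrap-around without modular arithmetic; likewise for
  \<open>rim_pred\<close>.\<close>

definition rim_succ :: "nat \<Rightarrow> nat \<Rightarrow> nat" where
  "rim_succ n i = (if Suc i = n then 0 else Suc i)"

definition rim_pred :: "nat \<Rightarrow> nat \<Rightarrow> nat" where
  "rim_pred n i = (if i = 0 then n - 1 else i - 1)"

lemma rim_neighbours:
  assumes "n \<ge> 3" and "i < n"
  shows "rim_succ n i < n" "rim_pred n i < n" "rim_succ n i \<noteq> i" "rim_pred n i \<noteq> i"
    "rim_succ n i \<noteq> rim_pred n i"
  using assms by (auto simp: rim_succ_def rim_pred_def)

lemma verts_wheel_graph [simp]: "verts (wheel_graph n) = {0..n}"
  by (simp add: wheel_graph_def)

lemma wheel_graph_adj_iff:
  assumes "n \<ge> 3"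
  shows "u \<rightarrow>\<^bsub>wheel_graph n\<^esub> v \<longleftrightarrow>
    u = n \<and> v < n \<or> v = n \<and> u < n \<or> v < n \<and> (u = rim_succ n v \<or> u = rim_pred n v)"
proof -
  have "u \<rightarrow>\<^bsub>wheel_graph n\<^esub> v \<longleftrightarrow> (u, v) \<in> wheel_edges n \<or> (v, u) \<in> wheel_edges n"
    by (force simp: arcs_ends_conv wheel_graph_def)
  also have "\<dots> \<longleftrightarrow> u = n \<and> v < n \<or> v = n \<and> u < n \<or>
      u < n \<and> v = Suc u mod n \<or> v < n \<and> u = Suc v mod n"
    by (auto simp: wheel_edges_def)
  also have "v < n \<and> u = Suc v mod n \<longleftrightarrow> v < n \<and> u = rim_succ n v"
    by (auto simp: rim_succ_def mod_Suc)
  also have "u < n \<and> v = Suc u mod n \<longleftrightarrow> v < n \<and> u = rim_pred n v"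
    using assms by (auto simp: rim_pred_def mod_Suc split: if_splits)
  finally show ?thesis by blast
qed

lemma closed_neighborhood_rim:
  assumes "n \<ge> 3" and "i < n"
  shows "closed_neighborhood (wheel_graph n) i = {i, n, rim_succ n i, rim_pred n i}"
  using assms by (auto simp: closed_neighborhood_def wheel_graph_adj_iff)

lemma closed_neighborhood_centre:
  assumes "n \<ge> 3"
  shows "closed_neighborhood (wheel_graph n) n = {0..n}"
  using assms by (auto simp: closed_neighborhood_def wheel_graph_adj_iff)

section \<open>The lower bound\<close>

text \<open>A centre of value 2 is a common neighbour of all rim vertices, so C2 leaves room for
  only one -1. If the centre has value -1, any 2 dominating a rim vertex of value -1 lies on the rim
  and hence is also adjacent to the centre, against C2.\<close>

lemma wheel_card_minus_one_le_1:
  assumes n: "n \<ge> 3" and f: "PLSRD_function (wheel_graph n) f" and centre: "f n \<noteq> 1"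
  shows "card {v \<in> {0..n}. f v = -1} \<le> 1"
proof -
  note P = f[unfolded PLSRD_function_def verts_wheel_graph]
  have cases: "f n \<in> {-1, 1, 2}"
    using bspec[OF conjunct1[OF P], of n] by simp
  have dom: "\<exists>u. u \<rightarrow>\<^bsub>wheel_graph n\<^esub> v \<and> f u = 2" if "v \<le> n" "f v = -1" for v
    using bspec[OF conjunct1[OF conjunct2[OF P]], of v] that by auto
  have C2: "v = w" if "v \<le> n" "w \<le> n" "f v = -1" "f w = -1"
    "u \<rightarrow>\<^bsub>wheel_graph n\<^esub> v" "u \<rightarrow>\<^bsub>wheel_graph n\<^esub> w" "f u = 2" for u v w
    using bspec[OF bspec[OF conjunct1[OF conjunct2[OF conjunct2[OF P]]], of v], of w] that by auto
  have "v = w" if vw: "v \<le> n" "w \<le> n" "f v = -1" "f w = -1" for v w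
  proof (cases "f n = 2")
    case True
    then have "v < n" "w < n"
      using vw by (auto simp: le_less)
    then show ?thesis
      using C2[of v w n] vw True n by (simp add: wheel_graph_adj_iff)
  next
    case False
    then have n1: "f n = -1"
      using cases centre by auto
    have "x = n" if x: "x \<le> n" "f x = -1" for x
    proof (rule ccontr)
      assume "x \<noteq> n"
      obtain u where u: "u \<rightarrow>\<^bsub>wheel_graph n\<^esub> x" "f u = 2"
        using dom x by blast
      moreover have "u < n"
        using u False x \<open>x \<noteq> n\<close> rim_neighbours[OF n, of x] n
        by (auto simp: wheel_graph_adj_iff)
      ultimately show False
        using C2[of x n u] x n1 n \<open>x \<noteq> n\<close> by (simp add: wheel_graph_adj_iff)
    qed
    then show ?thesis
      using vw by blast
  qed
  then show ?thesis
    by (auto simp: card_le_Suc0_iff_eq)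
qed

text \<open>With centre 1, all vertices of value -1 or 2 lie on the rim, and there are at least as
  many 2s as -1s. Equality makes the rim labels 4-periodic, which cannot close up when
  \<open>n mod 4 = 2\<close>.\<close>

lemma wheel_card_minus_one_le_half:
  assumes n: "n \<ge> 3" and f: "PLSRD_function (wheel_graph n) f" and centre: "f n = 1"
  shows "2 * card {v \<in> {0..n}. f v = -1} \<le> n"
    and "n mod 4 = 2 \<Longrightarrow> 2 * card {v \<in> {0..n}. f v = -1} \<noteq> n"
proof -
  interpret graph "wheel_graph n" by (rule graph_wheel_graph[OF n])
  define M where "M = {v \<in> {0..n}. f v = -1}"
  define T where "T = {v \<in> {0..n}. f v = 2}"
  have sub: "M \<union> T \<subseteq> {..<n}"
    using centre by (auto simp: M_def T_def le_less)
  have disj: "card (M \<union> T) = card M + card T"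
    by (rule card_Un_disjoint) (auto simp: M_def T_def)
  have le: "card M \<le> card T"
    using PLSRD_card_le[OF fin_digraph_axioms f] by (simp add: M_def T_def)
  have MT: "card M + card T \<le> n"
    using card_mono[OF _ sub] disj by simp
  show "2 * card {v \<in> {0..n}. f v = -1} \<le> n"
    using MT le by (simp add: M_def)
  assume n2: "n mod 4 = 2"
  show "2 * card {v \<in> {0..n}. f v = -1} \<noteq> n"
  proof
    assume "2 * card {v \<in> {0..n}. f v = -1} = n"
    then have cM: "2 * card M = n" by (simp add: M_def)
    then have cT: "card T = card M" using MT le by simp
    have "M \<union> T = {..<n}"
      by (rule card_subset_eq) (use sub disj cM cT in auto)
    then have vals: "f i = -1 \<or> f i = 2" if "i < n" for i
      using that by (auto simp: M_def T_def)
    obtain d where d: "inj_on d M" "d ` M \<subseteq> T" "\<And>v. v \<in> M \<Longrightarrow> d v \<rightarrow>\<^bsub>wheel_graph n\<^esub> v"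
      using PLSRD_private_neighbour[OF wf_digraph_axioms f]
      unfolding M_def T_def verts_wheel_graph by (metis (mono_tags, lifting) mem_Collect_eq)
    \<comment> \<open>An injection between finite sets of equal size: every 2 is the chosen
      dominator of some -1.\<close>
    have surj: "d ` M = T"
      by (rule card_subset_eq) (use d cT in \<open>auto simp: card_image T_def\<close>)
    \<comment> \<open>As only -1 and 2 occur on the rim, the sum is 1 exactly when the two
      neighbours differ.\<close>
    have alt: "f (rim_pred n i) + f (rim_succ n i) = 1" if i: "i < n" for i
    proof -
      note nb = rim_neighbours[OF n i]
      note adj = wheel_graph_adj_iff[OF n]
      have sym: "i \<rightarrow>\<^bsub>wheel_graph n\<^esub> rim_succ n i" "i \<rightarrow>\<^bsub>wheel_graph n\<^esub> rim_pred n i"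
        using i n by (auto simp: adj rim_succ_def rim_pred_def)
      have "\<not> (f (rim_pred n i) = f (rim_succ n i))"
      proof
        assume eq: "f (rim_pred n i) = f (rim_succ n i)"
        from vals[OF i] show False
        proof
          \<comment> \<open>The centre has value 1, so equal rim neighbours would give zero or two
            neighbours of value 2, against C1.\<close>
          assume "f i = -1"
          then have "\<exists>!u. u \<rightarrow>\<^bsub>wheel_graph n\<^esub> i \<and> f u = 2"
            using f i by (simp add: PLSRD_function_def)
          moreover have "rim_succ n i \<rightarrow>\<^bsub>wheel_graph n\<^esub> i" "rim_pred n i \<rightarrow>\<^bsub>wheel_graph n\<^esub> i"
            using i by (auto simp: adj)
          moreover have "u = n \<or> u = rim_succ n i \<or> u = rim_pred n i"
            if "u \<rightarrow>\<^bsub>wheel_graph n\<^esub> i" for u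
            using that i by (auto simp: adj)
          ultimately show False
            using nb(5) eq centre by (metis numeral_One numeral_eq_iff semiring_norm(85))
        next
          \<comment> \<open>By surjectivity one rim neighbour is -1; equality makes both -1, with
            \<open>i\<close> as a common neighbour of value 2, against C2.\<close>
          assume "f i = 2"
          then have "i \<in> T" using i by (simp add: T_def)
          then obtain v where v: "v \<in> M" "i = d v"
            using surj by blast
          then have "i \<rightarrow>\<^bsub>wheel_graph n\<^esub> v" "v < n"
            using d(3) sub by auto
          then have "v = rim_succ n i \<or> v = rim_pred n i"
            using i by (auto simp: adj rim_succ_def rim_pred_def split: if_splits)
          then have "f (rim_succ n i) = -1" "f (rim_pred n i) = -1"
            using v eq by (auto simp: M_def)
          then show False
            using f sym nb \<open>f i = 2\<close> unfolding PLSRD_function_def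
            by (metis atLeastAtMost_iff le0 less_imp_le verts_wheel_graph)
        qed
      qed
      then show ?thesis
        using vals[OF nb(1)] vals[OF nb(2)] by auto
    qed
    have step: "f (j + 2) = 1 - f j" if "j + 2 < n" for j
      using alt[of "j + 1"] that by (simp add: rim_pred_def rim_succ_def)
    have period: "f (4 * j) = f 0" if "4 * j < n" for j
      using that
    proof (induction j)
      case (Suc j)
      then show ?case
        using step[of "4 * j"] step[of "4 * j + 2"] by (simp add: algebra_simps numeral_eq_Suc)
    qed simp
    have "n - 2 = 4 * (n div 4)"
      using n2 by presburger
    then have "f (n - 2) = f 0"
      using period[of "n div 4"] n by simp
    \<comment> \<open>The rim neighbours of \<open>n - 1\<close> are \<open>n - 2\<close> and 0.
      Together with periodicity this gives \<open>2 * f 0 = 1\<close>, impossible by parity.\<close>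
    moreover have "f (n - 2) + f 0 = 1"
      using alt[of "n - 1"] n by (simp add: rim_pred_def rim_succ_def numeral_2_eq_2)
    ultimately show False
      by presburger
  qed
qed

lemma wheel_weight_ge:
  assumes n: "n \<ge> 4" and f: "PLSRD_function (wheel_graph n) f"
  shows "weight (wheel_graph n) f \<ge> int (n div 2) + (if n mod 4 = 0 then 1 else 2)"
proof -
  have n3: "n \<ge> 3" using n by simp
  interpret graph "wheel_graph n" by (rule graph_wheel_graph[OF n3])
  have w: "weight (wheel_graph n) f \<ge> int n + 1 - int (card {v \<in> {0..n}. f v = -1})"
    using PLSRD_weight_ge[OF fin_digraph_axioms f] by simp
  show ?thesis
  proof (cases "f n = 1")
    case True
    note half = wheel_card_minus_one_le_half[OF n3 f True]
    define m where "m = card {v \<in> {0..n}. f v = -1}"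
    have "2 * m \<le> n" "n mod 4 = 2 \<longrightarrow> 2 * m \<noteq> n"
      using half by (auto simp: m_def)
    \<comment> \<open>The largest possible \<open>m\<close> is \<open>n div 2\<close>, or one less
      than that when \<open>n mod 4 = 2\<close>.\<close>
    then have "n + 1 - m \<ge> n div 2 + (if n mod 4 = 0 then 1 else 2)" "m \<le> n"
      by (auto split: if_splits; presburger)+
    then show ?thesis
      using w unfolding m_def[symmetric] by (auto split: if_splits)
  next
    case False
    have "n \<ge> n div 2 + (if n mod 4 = 0 then 1 else 2)"
      using n by (auto; presburger)
    then show ?thesis
      using w wheel_card_minus_one_le_1[OF n3 f False] by (auto split: if_splits)
  qed
qed

section \<open>The construction\<close>

text \<open>The guard \<open>i < n\<close> keeps the centre at 1: for \<open>n mod 4 = 3\<close> the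
  vertex \<open>n\<close> would otherwise receive 2. In that residue class the tail 1, -1, 2 has
  weight 2, one less than three 1s.\<close>

definition wheel_labelling :: "nat \<Rightarrow> nat \<Rightarrow> int" where
  "wheel_labelling n i =
    (if i < 4 * (n div 4) then if i mod 4 = 0 \<or> i mod 4 = 3 then 2 else -1
     else if n mod 4 = 3 \<and> i < n
     then if i mod 4 = 0 then 1 else if i mod 4 = 1 then -1 else 2
     else 1)"

text \<open>Each full block contributes 2; the tail together with the centre contributes 1, 2, 3, 3
  for the residues 0, 1, 2, 3.\<close>

lemma sum_wheel_labelling:
  "(\<Sum>i\<le>n. wheel_labelling n i) = int (n div 2) + (if n mod 4 = 0 then 1 else 2)"
proof -
  define k where "k = n div 4"
  have blocks: "(\<Sum>i<4 * j. wheel_labelling n i) = 2 * int j" if "j \<le> k" for j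
    using that
  proof (induction j)
    case (Suc j)
    have "{..<4 * Suc j} = {..<Suc (Suc (Suc (Suc (4 * j))))}" by auto
    moreover have "wheel_labelling n (4 * j) = 2" "wheel_labelling n (Suc (4 * j)) = -1"
      "wheel_labelling n (Suc (Suc (4 * j))) = -1" "wheel_labelling n (Suc (Suc (Suc (4 * j)))) = 2"
      using Suc.prems by (simp_all add: wheel_labelling_def k_def mod_Suc)
    ultimately have "(\<Sum>i<4 * Suc j. wheel_labelling n i) = (\<Sum>i<4 * j. wheel_labelling n i) + 2"
      by (simp only: sum.lessThan_Suc)
    then show ?case
      using Suc by simp
  qed simp
  have n: "n = 4 * k + n mod 4" by (simp add: k_def)
  consider "n mod 4 = 0" | "n mod 4 = 1" | "n mod 4 = 2" | "n mod 4 = 3"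
    by linarith
  then show ?thesis
  proof cases
    case 1
    then have n': "n = 4 * k" using n by simp
    have "{..n} = {..<Suc (4 * k)}" unfolding n' by auto
    moreover have "wheel_labelling n (4 * k) = 1" by (simp add: n' wheel_labelling_def)
    ultimately show ?thesis using blocks[of k] 1 n' by simp
  next
    case 2
    then have n': "n = 4 * k + 1" using n by simp
    have "{..n} = {..<Suc (Suc (4 * k))}" unfolding n' by auto
    moreover have "wheel_labelling n (4 * k) = 1" "wheel_labelling n (Suc (4 * k)) = 1"
      using 2 by (simp_all add: k_def wheel_labelling_def)
    ultimately show ?thesis using blocks[of k] 2 n' by simp
  next
    case 3
    then have n': "n = 4 * k + 2" using n by simp
    have "{..n} = {..<Suc (Suc (Suc (4 * k)))}" unfolding n' by auto
    moreover have "wheel_labelling n (4 * k) = 1" "wheel_labelling n (Suc (4 * k)) = 1"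
      "wheel_labelling n (Suc (Suc (4 * k))) = 1"
      using 3 by (simp_all add: k_def wheel_labelling_def)
    ultimately show ?thesis using blocks[of k] 3 n' by simp
  next
    case 4
    then have n': "n = 4 * k + 3" using n by simp
    have "{..n} = {..<Suc (Suc (Suc (Suc (4 * k))))}" unfolding n' by auto
    moreover have "wheel_labelling n (4 * k) = 1" "wheel_labelling n (Suc (4 * k)) = -1"
      "wheel_labelling n (Suc (Suc (4 * k))) = 2" "wheel_labelling n (Suc (Suc (Suc (4 * k)))) = 1"
      using 4 n' by (simp_all add: wheel_labelling_def mod_Suc)
    ultimately show ?thesis using blocks[of k] 4 n' by simp
  qed
qed

text \<open>One local property of the rim that yields C1, C2 and, since the centre has value 1, also
  C3 at rim vertices.\<close>

lemma wheel_labelling_rim_neighbours: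
  assumes "n \<ge> 4" "i < n"
  shows "if wheel_labelling n i = -1
    then (wheel_labelling n (rim_succ n i) = 2) \<noteq> (wheel_labelling n (rim_pred n i) = 2)
    else wheel_labelling n (rim_succ n i) \<noteq> -1 \<or> wheel_labelling n (rim_pred n i) \<noteq> -1"
proof -
  obtain k r where n: "n = 4 * k + r" "r = 0 \<or> r = 1 \<or> r = 2 \<or> r = 3"
  proof
    show "n = 4 * (n div 4) + n mod 4" by simp
  qed linarith
  have k: "k > 0" using n assms(1) by auto
  obtain q s where i: "i = 4 * q + s" "s = 0 \<or> s = 1 \<or> s = 2 \<or> s = 3"
  proof
    show "i = 4 * (i div 4) + i mod 4" by simp
  qed linarith
  \<comment> \<open>The label in block coordinates: block \<open>p\<close>, offset \<open>t\<close>.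
    This turns the claim into a finite case check, in which the wrap-around is covered by
    \<open>first\<close> and \<open>last\<close>.\<close>
  define L where "L p t =
      (if p < k then if t = 0 \<or> t = 3 then 2 else -1
       else if r = 3 \<and> p = k \<and> t < 3 then if t = 0 then 1 else if t = 1 then -1 else 2
       else (1::int))" for p t :: nat
  have lab: "wheel_labelling n (4 * p + t) = L p t" if "t < 4" for p t
    using n that by (auto simp: wheel_labelling_def L_def)
  have qk: "q \<le> k" "q = k \<longrightarrow> s < r"
    using assms(2) n i by auto
  have last: "wheel_labelling n (n - 1) = (if r = 0 \<or> r = 3 then 2 else 1)"
  proof (cases "r = 0")
    case True
    then have "n - 1 = 4 * (k - 1) + 3" using n k by simp
    then show ?thesis using lab[of 3 "k - 1"] True k by (simp add: L_def)
  next
    case False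
    then have "n - 1 = 4 * k + (r - 1)" using n by simp
    then show ?thesis using lab[of "r - 1" k] False n(2) by (auto simp: L_def)
  qed
  have first: "wheel_labelling n 0 = 2"
    using lab[of 0 0] k by (simp add: L_def)
  have eq: "wheel_labelling n i = L q s"
    using lab[of s q] i by auto
  have "wheel_labelling n (rim_succ n i) =
      (if Suc i = n then 2 else if s = 3 then L (Suc q) 0 else L q (Suc s))"
    using i first lab[of 0 "Suc q"] lab[of "Suc s" q] by (auto simp: rim_succ_def)
  \<comment> \<open>The last rim vertex ends either the incomplete block \<open>k\<close> or, when
    \<open>r = 0\<close>, the full block \<open>k - 1\<close>.\<close>
  moreover have "Suc i = n \<longleftrightarrow> q = k \<and> Suc s = r \<or> Suc q = k \<and> s = 3 \<and> r = 0"
    using n i by presburger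
  ultimately have succ: "wheel_labelling n (rim_succ n i) =
      (if q = k \<and> Suc s = r \<or> Suc q = k \<and> s = 3 \<and> r = 0 then 2
       else if s = 3 then L (Suc q) 0 else L q (Suc s))"
    by simp
  have "i - 1 = 4 * (q - 1) + 3" if "s = 0" "q \<noteq> 0"
    using i that by simp
  then have pred: "wheel_labelling n (rim_pred n i) =
      (if s = 0 then if q = 0 then if r = 0 \<or> r = 3 then 2 else 1 else L (q - 1) 3 else L q (s - 1))"
    using i last lab[of 3 "q - 1"] lab[of "s - 1" q] by (auto simp: rim_pred_def numeral_2_eq_2)
  show ?thesis
    unfolding eq succ pred L_def using n(2) i(2) qk k by (elim disjE) auto
qed

lemma PLSRD_wheel_labelling:
  assumes n: "n \<ge> 4"
  shows "PLSRD_function (wheel_graph n) (wheel_labelling n)"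
proof -
  let ?f = "wheel_labelling n"
  have n3: "n \<ge> 3" using n by simp
  note adj = wheel_graph_adj_iff[OF n3]
  have vals: "?f i = -1 \<or> ?f i = 1 \<or> ?f i = 2" for i
    by (simp add: wheel_labelling_def)
  have centre: "?f n = 1"
    by (simp add: wheel_labelling_def)
  have C1: "\<exists>!u. u \<rightarrow>\<^bsub>wheel_graph n\<^esub> v \<and> ?f u = 2" if v: "v \<le> n" "?f v = -1" for v
  proof -
    have "v < n" using v centre by (auto simp: le_less)
    then have "u \<rightarrow>\<^bsub>wheel_graph n\<^esub> v \<and> ?f u = 2 \<longleftrightarrow>
        (u = rim_succ n v \<or> u = rim_pred n v) \<and> ?f u = 2" for u
      using centre by (auto simp: adj)
    then show ?thesis
      using wheel_labelling_rim_neighbours[OF n \<open>v < n\<close>] v(2) by metis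
  qed
  have C2: "v = w" if vw: "v \<le> n" "w \<le> n" "?f v = -1" "?f w = -1"
    and u: "u \<rightarrow>\<^bsub>wheel_graph n\<^esub> v" "u \<rightarrow>\<^bsub>wheel_graph n\<^esub> w" "?f u = 2" for u v w
  proof -
    have "v < n" "w < n" using vw centre by (auto simp: le_less)
    moreover have "u < n"
      using u(1,3) \<open>v < n\<close> centre rim_neighbours[OF n3] by (auto simp: adj)
    \<comment> \<open>Adjacency read from \<open>u\<close>: distinct \<open>v\<close> and
      \<open>w\<close> would be both rim neighbours of a 2, each of value -1.\<close>
    ultimately have "v = rim_succ n u \<or> v = rim_pred n u" "w = rim_succ n u \<or> w = rim_pred n u"
      using u by (auto simp: adj rim_succ_def rim_pred_def split: if_splits)
    then show ?thesis
      using wheel_labelling_rim_neighbours[OF n \<open>u < n\<close>] u(3) vw by auto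
  qed
  have C3: "(\<Sum>u \<in> closed_neighborhood (wheel_graph n) v. ?f u) \<ge> 1" if "v \<le> n" for v
  proof (cases "v = n")
    case True
    then show ?thesis
      using sum_wheel_labelling[of n] closed_neighborhood_centre[OF n3]
      by (simp add: atMost_atLeast0)
  next
    case False
    then have v: "v < n" using that by simp
    have "(\<Sum>u \<in> closed_neighborhood (wheel_graph n) v. ?f u)
        = ?f v + ?f n + ?f (rim_succ n v) + ?f (rim_pred n v)"
      using rim_neighbours[OF n3 v] v by (simp add: closed_neighborhood_rim[OF n3 v])
    \<comment> \<open>At a -1 the sum is at least -1 + 1 + 2 - 1; elsewhere it is at least 1 + 1 + 1
      - 1.\<close>
    then show ?thesis
      using wheel_labelling_rim_neighbours[OF n v] centre
        vals[of v] vals[of "rim_succ n v"] vals[of "rim_pred n v"]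
      by (auto split: if_splits)
  qed
  show ?thesis
    unfolding PLSRD_function_def using vals C1 C2 C3 by auto
qed

theorem proposition4:
  fixes n :: nat
  assumes "n \<ge> 4"
  shows "PLSRD_number (wheel_graph n) =
    (if n mod 4 = 0 then \<lceil>real n / 2\<rceil> + 1 else \<lceil>(real n + 1) / 2\<rceil> + 1)"
proof -
  have "PLSRD_number (wheel_graph n) = int (n div 2) + (if n mod 4 = 0 then 1 else 2)"
    unfolding PLSRD_number_def
  proof (rule Min_eqI)
    show "finite {weight (wheel_graph n) f | f. PLSRD_function (wheel_graph n) f}"
      by (rule finite_PLSRD_weights) simp
    show "int (n div 2) + (if n mod 4 = 0 then 1 else 2)
        \<in> {weight (wheel_graph n) f | f. PLSRD_function (wheel_graph n) f}"
      using PLSRD_wheel_labelling[OF assms] sum_wheel_labelling[of n]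
      by (auto simp: weight_def atMost_atLeast0 intro!: exI[of _ "wheel_labelling n"])
  qed (use wheel_weight_ge[OF assms] in blast)
  \<comment> \<open>For \<open>n = 2 * k\<close> and for \<open>n = 2 * k + 1\<close> alike, the
    ceiling of \<open>(n + 1) / 2\<close> is \<open>k + 1\<close>, that is,
    \<open>n div 2 + 1\<close>.\<close>
  also have "\<dots> = (if n mod 4 = 0 then \<lceil>real n / 2\<rceil> + 1 else \<lceil>(real n + 1) / 2\<rceil> + 1)"
  proof (cases "even n")
    case True
    then obtain k where "n = 2 * k" by blast
    moreover have "\<lceil>(2 * real k + 1) / 2\<rceil> = int k + 1"
      by (simp add: ceiling_eq_iff)
    ultimately show ?thesis by simp
  next
    case False
    then obtain k where "n = 2 * k + 1" by (blast elim: oddE)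
    moreover from this have "n mod 4 \<noteq> 0" by presburger
    moreover have "\<lceil>(2 + 2 * real k) / 2\<rceil> = int k + 1"
      by (simp add: ceiling_eq_iff)
    ultimately show ?thesis by simp
  qed
  finally show ?thesis .
qed

end
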